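(* Let $W$ be an infinite word over $\{0,1\}$ that starts with $0$ and is generated by an $r$-uniform morphism $\mu:\{0,1\}^*\to\{0,1\}^*$. Then: (1) $W$ is aperiodic if and only if $\mu(0)\neq\mu(1)$ and $W\notin\{0000\cdots,\,0111\cdots,\,0101\cdots\}$. (2) $W$ is uniformly recurrent if and only if $W=0000\cdots$ or $\mu(1)\neq 11\cdots 1$ (where $11\cdots1$ denotes the word consisting of $r$ ones).
   Context: Infinite words are infinite to the right only. $\mathcal A^*$ is the set of all finite words over $\mathcal A$ (the free monoid). A morphism is a map $\mu:\mathcal A^*\to\mathcal A^*$ with $\mu(ww')=\mu(w)\mu(w')$ for all $w,w'\in\mathcal A^*$. It is $r$-uniform if $\mu(a)$ has length $r$ for every $a\in\mathcal A$. It is prolongable at $a\in\mathcal A$ if $\mu(a)=as$ for some nonempty word $s$; in that case the sequence $a,\mu(a),\mu^2(a),\ldots$ converges to an infinite word $\mu^\omega(a)$. An infinite word $W$ is generated by $\mu$ if $W=\mu^\omega(a)$ for some letter $a$ at which $\mu$ is prolongable (so if $\mu$ is $r$-uniform, necessarily $r\ge 2$, and $a$ is the first letter of $W$). A factor of a word is a contiguous subword. An infinite word is aperiodic if it is not eventually periodic. An infinite word $W$ is uniformly recurrent if for every finite factor $w$ of $W$ there is a positive integer $n$ such that every factor of $W$ of length $n$ contains $w$ as a factor. The infinite words $0000\cdots$, $0111\cdots$, $0101\cdots$ are respectively the all-zeros word, a single $0$ followed by all ones, and the periodic repetition of $01$. *)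

theory Defs
  imports
    "HOL-Library.Z2"
    "HOL-Library.Sublist"
    "HOL-Library.Omega_Words_Fun"
begin

definition word_morphism :: "('a list \<Rightarrow> 'a list) \<Rightarrow> bool" where
  "word_morphism \<mu> \<longleftrightarrow> (\<forall>w w'. \<mu> (w @ w') = \<mu> w @ \<mu> w')"

definition uniform_on_letters :: "nat \<Rightarrow> ('a list \<Rightarrow> 'a list) \<Rightarrow> bool" where
  "uniform_on_letters r \<mu> \<longleftrightarrow> (\<forall>a. length (\<mu> [a]) = r)"

definition prolongable_at :: "('a list \<Rightarrow> 'a list) \<Rightarrow> 'a \<Rightarrow> bool" where
  "prolongable_at \<mu> a \<longleftrightarrow> (\<exists>s. s \<noteq> [] \<and> \<mu> [a] = a # s)"

text \<open>Convergence of finite words to an infinite word is letterwise: at every position,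
  all but finitely many of the finite words are long enough and agree with the limit.\<close>

definition converges_to_word :: "(nat \<Rightarrow> 'a list) \<Rightarrow> 'a word \<Rightarrow> bool" where
  "converges_to_word u W \<longleftrightarrow>
     (\<forall>i. \<forall>\<^sub>F k in sequentially. i < length (u k) \<and> u k ! i = W i)"

definition generated_by :: "'a word \<Rightarrow> ('a list \<Rightarrow> 'a list) \<Rightarrow> bool" where
  "generated_by W \<mu> \<longleftrightarrow>
     (\<exists>a. prolongable_at \<mu> a \<and> converges_to_word (\<lambda>k. (\<mu> ^^ k) [a]) W)"

definition factor_of_word :: "'a list \<Rightarrow> 'a word \<Rightarrow> bool" where
  "factor_of_word w W \<longleftrightarrow> (\<exists>i j. w = W [i \<rightarrow> j])"

definition eventually_periodic :: "'a word \<Rightarrow> bool" where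
  "eventually_periodic W \<longleftrightarrow> (\<exists>p>0. \<exists>N. \<forall>i\<ge>N. W (i + p) = W i)"

definition aperiodic :: "'a word \<Rightarrow> bool" where
  "aperiodic W \<longleftrightarrow> \<not> eventually_periodic W"

definition uniformly_recurrent :: "'a word \<Rightarrow> bool" where
  "uniformly_recurrent W \<longleftrightarrow>
     (\<forall>w. factor_of_word w W \<longrightarrow>
       (\<exists>n>0. \<forall>v. factor_of_word v W \<and> length v = n \<longrightarrow> sublist w v))"

end

theory Submission
  imports Defs "HOL-Number_Theory.Residues"
begin

text \<open>A generated word satisfies \<open>W (r * n + j) = \<mu> [W n] ! j\<close>.
  If \<open>\<mu>\<close> is injective on letters, an eventual period \<open>r * m\<close> of \<open>W\<close> can be
  divided by \<open>r\<close>, so the least eventual period \<open>p\<close> is coprime to \<open>r\<close>. For a power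
  \<open>R\<close> of \<open>r\<close> with \<open>R \<equiv> 1\<close> modulo \<open>p\<close>, the letters at \<open>n + 1\<close> and \<open>R * n + 1\<close>
  eventually agree, so each letter eventually determines the next one. Over two letters this
  leaves only eventually constant and eventually alternating words.

  For recurrence, each factor lies in a prefix of length \<open>R = r ^ k\<close>, and this prefix
  reappears at \<open>R * n\<close> whenever \<open>W n = W 0\<close>; if \<open>\<mu> [1]\<close> contains a zero, such \<open>n\<close> have
  bounded gaps. Otherwise powers of \<open>\<mu>\<close> turn a single one into arbitrarily long runs of ones.\<close>

section \<open>Eventual periods and fixed points of uniform substitutions\<close>

definition eventual_period :: "'a word \<Rightarrow> nat \<Rightarrow> bool" where
  "eventual_period W p \<longleftrightarrow> (\<exists>N. \<forall>i\<ge>N. W (i + p) = W i)"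

lemma eventual_period_mult:
  fixes W :: "'a word"
  assumes "\<forall>i\<ge>N. W (i + p) = W i" and "i \<ge> N"
  shows "W (i + p * m) = W i"
proof (induction m)
  case (Suc m)
  have "W (i + p * Suc m) = W ((i + p * m) + p)" by (simp add: algebra_simps)
  with assms Suc show ?case by simp
qed simp

lemma subsequence_split:
  assumes "i \<le> j" and "j \<le> k"
  shows "subsequence W i k = subsequence W i j @ subsequence W j k"
proof -
  have "[i..<k] = [i..<j] @ [j..<k]"
    using assms upt_add_eq_append[of i j "k - j"] by simp
  then show ?thesis by (simp add: subsequence_def)
qed

text \<open>\<open>f a j\<close> stands for letter \<open>j\<close> of the image of
  \<open>a\<close>; this identity is all that is kept of the morphism. Only positions
  \<open>j < r\<close> are constrained.\<close>

locale uniform_fixed_point =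
  fixes f :: "'a \<Rightarrow> nat \<Rightarrow> 'a" and r :: nat and W :: "'a word"
  assumes r_ge_2: "2 \<le> r"
    and fixed: "j < r \<Longrightarrow> W (r * n + j) = f (W n) j"
begin

lemma div_mod: "W m = f (W (m div r)) (m mod r)"
  using fixed[of "m mod r" "m div r"] r_ge_2 by simp

text \<open>\<open>W\<close> is also fixed by the \<open>k\<close>-th power of the substitution,
  which is \<open>r ^ k\<close>-uniform with letters \<open>F\<close>. In the step,
  \<open>j div r\<close> selects the letter of the smaller block and \<open>j mod r\<close> the
  place in its image.\<close>

lemma power_block: "\<exists>F. \<forall>n. \<forall>j<r ^ k. W (r ^ k * n + j) = F (W n) j"
proof (induction k)
  case 0
  show ?case by (auto intro!: exI[of _ "\<lambda>b j. b"])
next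
  case (Suc k)
  then obtain F where F: "\<And>n j. j < r ^ k \<Longrightarrow> W (r ^ k * n + j) = F (W n) j" by blast
  have "W (r ^ Suc k * n + j) = f (F (W n) (j div r)) (j mod r)" if "j < r ^ Suc k" for n j
  proof -
    have "j div r < r ^ k"
      using that by (simp add: less_mult_imp_div_less mult.commute)
    moreover have "r ^ Suc k * n + j = r * (r ^ k * n + j div r) + j mod r"
      by (simp add: algebra_simps)
    ultimately show ?thesis using fixed[of "j mod r"] F r_ge_2 by simp
  qed
  then show ?case by (intro exI[of _ "\<lambda>b j. f (F b (j div r)) (j mod r)"]) blast
qed

lemma block_cong:
  assumes "W m = W n" and "j < r ^ k"
  shows "W (r ^ k * m + j) = W (r ^ k * n + j)"
  using power_block[of k] assms by metis

text \<open>A shift by \<open>r * m\<close> carries the image of \<open>W i\<close> onto that of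
  \<open>W (i + m)\<close>, and injectivity recovers the letters from equal images.\<close>

lemma eventual_period_divide:
  assumes inj: "\<And>a b. (\<And>j. j < r \<Longrightarrow> f a j = f b j) \<Longrightarrow> a = b"
    and "eventual_period W (r * m)"
  shows "eventual_period W m"
proof -
  obtain N where N: "\<And>i. i \<ge> N \<Longrightarrow> W (i + r * m) = W i"
    using assms(2) unfolding eventual_period_def by blast
  have "W (i + m) = W i" if "i \<ge> N" for i
  proof (rule inj)
    fix j assume j: "j < r"
    have "1 * i \<le> r * i" using r_ge_2 by (intro mult_right_mono) auto
    then have "r * i + j \<ge> N" using that by linarith
    from N[OF this] have "W (r * (i + m) + j) = W (r * i + j)" by (simp add: algebra_simps)
    then show "f (W (i + m)) j = f (W i) j" using fixed[OF j] by simp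
  qed
  then show ?thesis unfolding eventual_period_def by blast
qed

text \<open>For the least eventual period \<open>p\<close> and \<open>d = gcd r p\<close>, the
  multiple \<open>p * (r div d) = r * (p div d)\<close> is again a period. Cancelling
  \<open>r\<close> leaves \<open>p div d\<close>, so minimality forces \<open>d = 1\<close>.\<close>

lemma coprime_eventual_period:
  assumes inj: "\<And>a b. (\<And>j. j < r \<Longrightarrow> f a j = f b j) \<Longrightarrow> a = b"
    and "eventually_periodic W"
  obtains p where "p > 0" "eventual_period W p" "coprime r p"
proof -
  define P where "P p \<longleftrightarrow> p > 0 \<and> eventual_period W p" for p
  have "\<exists>p. P p" using assms(2) unfolding P_def eventually_periodic_def eventual_period_def by blast
  define p where "p = (LEAST p. P p)"
  have p: "p > 0" "eventual_period W p"
    using LeastI_ex[OF \<open>\<exists>p. P p\<close>] by (auto simp: p_def P_def)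
  have least: "p \<le> q" if "P q" for q using that unfolding p_def by (rule Least_le)
  define d where "d = gcd r p"
  have d: "d > 0" "d dvd r" "d dvd p" using p by (auto simp: d_def)
  obtain N where "\<forall>i\<ge>N. W (i + p) = W i" using p(2) unfolding eventual_period_def by blast
  then have "eventual_period W (p * (r div d))"
    unfolding eventual_period_def using eventual_period_mult by blast
  moreover have "p * (r div d) = r * (p div d)"
    using d by (metis div_mult_swap mult.commute)
  ultimately have "eventual_period W (p div d)" using eventual_period_divide[OF inj] by simp
  moreover have "p div d > 0" using d p by (simp add: dvd_imp_le div_greater_zero_iff)
  ultimately have "p \<le> p div d" using least by (simp add: P_def)
  then have "d = 1" using d p by (metis div_less_dividend leD nat_neq_iff less_one)
  then have "coprime r p" by (simp add: d_def coprime_iff_gcd_eq_1)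
  with p that show ?thesis by blast
qed

text \<open>Euler's theorem gives \<open>r ^ k = 1 + p * m\<close>, so \<open>r ^ k * n + 1\<close>
  differs from \<open>n + 1\<close> by a multiple of \<open>p\<close>, yet lies in the block
  determined by \<open>W n\<close>.\<close>

lemma next_letter_determined:
  assumes "p > 0" and "eventual_period W p" and "coprime r p"
  obtains g N where "\<And>n. n \<ge> N \<Longrightarrow> W (Suc n) = g (W n)"
proof -
  define k where "k = totient p"
  have "k > 0" using assms(1) by (simp add: k_def)
  \<comment> \<open>The block must be longer than one letter for offset 1 to lie inside it.\<close>
  then have R: "r ^ k > 1" using r_ge_2 one_less_power[of r k] by simp
  have "[r ^ k = 1] (mod p)" unfolding k_def by (rule euler_theorem) (use assms in simp)
  then have "p dvd r ^ k - 1" using R by (simp add: cong_altdef_nat)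
  then obtain m where "r ^ k - 1 = p * m" by blast
  then have m: "r ^ k = Suc (p * m)" using R by simp
  obtain N where N: "\<forall>i\<ge>N. W (i + p) = W i" using assms(2) unfolding eventual_period_def by blast
  obtain F where F: "\<And>n j. j < r ^ k \<Longrightarrow> W (r ^ k * n + j) = F (W n) j"
    using power_block by blast
  have "W (Suc n) = F (W n) 1" if "n \<ge> N" for n
  proof -
    have "W (Suc n) = W (Suc n + p * (m * n))"
      using eventual_period_mult[OF N, of "Suc n"] that by simp
    also have "Suc n + p * (m * n) = r ^ k * n + 1" by (simp add: m algebra_simps)
    also have "W \<dots> = F (W n) 1" using F R by blast
    finally show ?thesis .
  qed
  then show ?thesis by (rule that[where g = "\<lambda>b. F b 1"])
qed

lemma prefix_recurs:
  assumes gaps: "\<And>m. \<exists>n\<ge>m. n < m + g \<and> W n = W 0"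
  shows "uniformly_recurrent W"
  unfolding uniformly_recurrent_def
proof (intro allI impI)
  fix w assume "factor_of_word w W"
  then obtain i j where w: "w = subsequence W i j" unfolding factor_of_word_def by blast
  \<comment> \<open>A power of \<open>r\<close> above \<open>i + j\<close>, so that \<open>w\<close>
    lies inside the prefix of length \<open>R\<close>.\<close>
  define R where "R = r ^ (Suc (i + j))"
  have "i + j < 2 ^ (i + j)" by (rule less_exp)
  also have "\<dots> \<le> R" unfolding R_def
    using r_ge_2 by (intro order.trans[OF power_increasing power_mono]) auto
  finally have ij: "i + j < R" .
  show "\<exists>n>0. \<forall>v. factor_of_word v W \<and> length v = n \<longrightarrow> sublist w v"
  \<comment> \<open>Less than one block is lost before the first boundary after \<open>a\<close>;
    one of the next \<open>g\<close> aligned blocks is a copy of the prefix, and the window covers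
    them all.\<close>
  proof (intro exI[of _ "R * (g + 2)"] conjI allI impI)
    show "0 < R * (g + 2)" using ij by simp
    fix v assume "factor_of_word v W \<and> length v = R * (g + 2)"
    then obtain a b where v: "v = subsequence W a b" and len: "b - a = R * (g + 2)"
      unfolding factor_of_word_def by auto
    obtain n where n: "n \<ge> Suc (a div R)" "n < Suc (a div R) + g" "W n = W 0"
      using gaps by blast
    have "a < R * Suc (a div R)"
      using ij by (metis dividend_less_times_div gr_implies_not0 mult_Suc_right neq0_conv add.commute)
    also have "\<dots> \<le> R * n" using n by (intro mult_left_mono) auto
    finally have lo: "a \<le> R * n" by simp
    have "R * n + R = R * Suc n" by simp
    also have "\<dots> \<le> R * (a div R + (g + 2))" using n by (intro mult_left_mono) auto
    also have "\<dots> = R * (a div R) + R * (g + 2)" by (rule distrib_left)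
    also have "\<dots> \<le> a + R * (g + 2)" by simp
    also have "\<dots> \<le> b" using len ij by (cases "a \<le> b") auto
    finally have hi: "R * n + R \<le> b" .
    have "W (R * n + t) = W t" if "t < R" for t
      using block_cong[of n 0 t "Suc (i + j)"] n(3) that by (simp add: R_def)
    then have "w = subsequence W (R * n + i) (R * n + j)"
      using ij unfolding w subsequence_def by (intro nth_equalityI) (auto simp: add.assoc)
    also have "sublist \<dots> v"
    \<comment> \<open>The indices of a factor need not be ordered; for \<open>i > j\<close> the
      factor is empty.\<close>
    proof (cases "i \<le> j")
      case True
      have "v = subsequence W a (R * n + i) @ subsequence W (R * n + i) (R * n + j)
          @ subsequence W (R * n + j) b"
        using True lo hi ij unfolding v by (simp flip: subsequence_split)
      then show ?thesis by (auto simp: sublist_def)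
    qed (simp add: subsequence_def)
    finally show "sublist w v" .
  qed
qed

end

section \<open>Binary fixed points starting with zero\<close>

lemma bit_cases: "b = 0 \<or> b = 1" for b :: bit
  by (cases b) auto

lemma bit_step: "a \<noteq> b \<longleftrightarrow> a = b + 1" for a b :: bit
  using bit_cases[of a] bit_cases[of b] by auto

locale binary_fixed_point = uniform_fixed_point f r W
  for f :: "bit \<Rightarrow> nat \<Rightarrow> bit" and r W +
  assumes W_0: "W 0 = 0"
begin

lemma image_0_0: "f 0 0 = 0"
  using div_mod[of 0] W_0 by simp

text \<open>Since \<open>f 0 0 = 0\<close>, a zero at \<open>m\<close> yields one at
  \<open>r * m\<close>, which is strictly larger when \<open>m > 0\<close>.\<close>

lemma zeros_above:
  assumes "W n = 0" and "n > 0"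
  shows "\<exists>m\<ge>N. W m = 0"
proof (induction N)
  case (Suc N)
  show ?case
  proof (cases N)
    \<comment> \<open>The induction hypothesis may offer only position 0, which multiplication by
      \<open>r\<close> does not move; the given \<open>n\<close> serves instead.\<close>
    case 0
    with assms show ?thesis by (intro exI[of _ n]) auto
  next
    case (Suc N')
    obtain m where m: "m \<ge> N" "W m = 0" using Suc.IH by blast
    have "2 * m \<le> r * m" using r_ge_2 by (intro mult_right_mono) auto
    moreover have "W (r * m) = 0" using fixed[of 0 m] r_ge_2 m image_0_0 by simp
    moreover have "m > 0" using m Suc by simp
    ultimately have "Suc N \<le> r * m" "W (r * m) = 0" using m(1) by linarith+
    then show ?thesis by blast
  qed
qed (use assms in auto)

text \<open>A block far out shows that the image of 0 is all zeros; this then spreads from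
  \<open>W 0\<close> to every position.\<close>

lemma eventually_0_imp_0:
  assumes "\<And>n. n \<ge> N \<Longrightarrow> W n = 0"
  shows "W n = 0"
proof -
  have f: "f 0 j = 0" if "j < r" for j
  proof -
    have "N \<le> r * N" using r_ge_2 by simp
    then have "W (r * N + j) = 0" by (intro assms trans_le_add1)
    then show ?thesis using fixed[OF that, of N] assms[of N] by simp
  qed
  show ?thesis
  proof (induction n rule: less_induct)
    case (less n)
    show ?case
    proof (cases "n = 0")
      case False
      then have "W (n div r) = 0" using r_ge_2 by (intro less) simp
      then show ?thesis using div_mod[of n] f r_ge_2 by simp
    qed (simp add: W_0)
  qed
qed

text \<open>Alternation makes \<open>p\<close> even, hence \<open>r\<close> odd by coprimality. Each
  image then alternates from its own letter, and consecutive blocks fit together.\<close>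

lemma eventually_alternating_imp_alternating:
  assumes p: "eventual_period W p" "coprime r p"
    and alt: "\<And>n. n \<ge> N \<Longrightarrow> W (Suc n) = W n + 1"
  shows "W n = of_nat n"
proof -
  have alt': "W (n + j) = W n + of_nat j" if "n \<ge> N" for n j
    using that by (induction j) (simp_all add: alt add_ac)
  obtain M where M: "\<And>i. i \<ge> M \<Longrightarrow> W (i + p) = W i"
    using p(1) unfolding eventual_period_def by blast
  \<comment> \<open>In \<open>bit\<close>, \<open>of_nat\<close> is parity: a shift by
    \<open>p\<close> both preserves the letter and adds \<open>of_nat p\<close>.\<close>
  have "of_nat p = (0 :: bit)"
    using M[of "max M N"] alt'[of "max M N" p]
    by (metis add_left_cancel add.right_neutral max.cobounded1 max.cobounded2)
  then have "even p" by (cases "even p") (auto elim: oddE)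
  then have "odd r" using p(2) by (metis coprime_common_divisor odd_one)
  then have r: "of_nat r = (1 :: bit)" by (auto elim: oddE)
  have image: "f (W n) j = W n + of_nat j" if "n \<ge> N" "j < r" for n j
  proof -
    have le: "n \<le> r * n" using r_ge_2 by simp
    then obtain d where d: "r * n = n + d" using le_Suc_ex by blast
    have "(of_nat (r * n) :: bit) = of_nat n" using r by simp
    then have "of_nat d = (0 :: bit)" unfolding d by (metis add_left_cancel add.right_neutral of_nat_add)
    then have "W (r * n + j) = W n + of_nat j" using alt'[OF that(1), of "d + j"] d
      by (simp add: add.assoc)
    then show ?thesis using fixed[OF that(2)] by simp
  qed
  have image': "f b j = b + of_nat j" if "j < r" for b j
  proof -
    \<comment> \<open>Both letters occur from \<open>N\<close> on, so the formula for images holds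
      for every letter.\<close>
    have "b = W N \<or> b = W (Suc N)" using alt[of N] bit_step by auto
    then show ?thesis using image[of N j] image[of "Suc N" j] that by (metis le_SucI order_refl)
  qed
  show ?thesis
  proof (induction n rule: less_induct)
    case (less n)
    show ?case
    proof (cases "n = 0")
      case False
      then have IH: "W (n div r) = of_nat (n div r)" using r_ge_2 by (intro less) simp
      have "W n = of_nat (n div r) + of_nat (n mod r)"
        using div_mod[of n] image' IH r_ge_2 by simp
      also have "\<dots> = of_nat (r * (n div r) + n mod r)" 
        by (simp only: of_nat_add of_nat_mult r mult_1_left)
      finally show ?thesis by simp
    qed (simp add: W_0)
  qed
qed

lemma eventually_periodic_cases:
  assumes "\<exists>j<r. f 0 j \<noteq> f 1 j" and "eventually_periodic W"
  shows "(\<forall>n. W n = 0) \<or> (\<forall>n>0. W n = 1) \<or> (\<forall>n. W n = of_nat n)"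
proof -
  have inj: "a = b" if "\<And>j. j < r \<Longrightarrow> f a j = f b j" for a b
    using assms(1) that bit_cases[of a] bit_cases[of b] by metis
  obtain p where p: "p > 0" "eventual_period W p" "coprime r p"
    using coprime_eventual_period[OF inj assms(2)] by blast
  obtain g N where g: "\<And>n. n \<ge> N \<Longrightarrow> W (Suc n) = g (W n)"
    using next_letter_determined[OF p] by blast
  show ?thesis
  \<comment> \<open>Since each letter determines the next, a single repetition beyond
    \<open>N\<close> makes \<open>W\<close> constant from there on; without one, \<open>W\<close>
    alternates.\<close>
  proof (cases "\<exists>n\<ge>N. W (Suc n) = W n")
    case True
    then obtain n where n: "n \<ge> N" "W (Suc n) = W n" by blast
    have const: "W m = W n" if "m \<ge> n" for m
      using that by (induction m rule: dec_induct) (use g n in auto)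
    show ?thesis
    proof (cases "W n = 0")
      case True
      then have "W m = 0" if "m \<ge> n" for m using const[OF that] by simp
      then show ?thesis using eventually_0_imp_0 by blast
    next
      case False
      then have "W m \<noteq> 0" if "m > 0" for m
        using zeros_above[OF _ that, of n] const by metis
      then show ?thesis using bit_cases by blast
    qed
  next
    case False
    then show ?thesis
      using eventually_alternating_imp_alternating[OF p(2,3)] bit_step by blast
  qed
qed

text \<open>Both images contain a zero, so every aligned block does, and a full aligned block starts
  within \<open>r\<close> letters of any position.\<close>

lemma uniformly_recurrent_if_zero_in_image:
  assumes "f 1 j = 0" and "j < r"
  shows "uniformly_recurrent W"
proof (rule prefix_recurs)
  fix m
  define q where "q = Suc (m div r)"
  have "\<exists>t<r. f (W q) t = 0"
    using bit_cases[of "W q"] assms image_0_0 r_ge_2 by (auto intro: exI[of _ 0] exI[of _ j])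
  then obtain t where t: "t < r" "f (W q) t = 0" by blast
  have "r * q = r * (m div r) + r" by (simp add: q_def)
  moreover have "m = r * (m div r) + m mod r" by simp
  moreover have "m mod r < r" using r_ge_2 by simp
  ultimately have "m \<le> r * q + t" "r * q + t < m + 2 * r" using t(1) by linarith+
  moreover have "W (r * q + t) = W 0" using fixed[OF t(1)] t(2) W_0 by simp
  ultimately show "\<exists>n\<ge>m. n < m + 2 * r \<and> W n = W 0" by blast
qed

lemma long_runs_of_ones:
  assumes "\<And>j. j < r \<Longrightarrow> f 1 j = 1" and "W n = 1" and "j < r ^ k"
  shows "W (r ^ k * n + j) = 1"
  using assms(3)
proof (induction k arbitrary: j)
  case (Suc k)
  have "j div r < r ^ k"
    using Suc.prems by (simp add: less_mult_imp_div_less mult.commute)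
  then have "W (r ^ k * n + j div r) = 1" by (rule Suc.IH)
  moreover have "r ^ Suc k * n + j = r * (r ^ k * n + j div r) + j mod r"
    by (simp add: algebra_simps)
  ultimately show ?case using fixed[of "j mod r"] assms(1) r_ge_2 by simp
qed (use assms(2) in simp)

text \<open>The factor \<open>[0]\<close> occurs at position 0, but the iterated images of a one
  avoid it for arbitrarily long stretches.\<close>

lemma not_uniformly_recurrent:
  assumes "\<And>j. j < r \<Longrightarrow> f 1 j = 1" and "W n = 1"
  shows "\<not> uniformly_recurrent W"
proof
  assume "uniformly_recurrent W"
  moreover have "factor_of_word [0] W"
    unfolding factor_of_word_def
    by (intro exI[of _ 0] exI[of _ 1]) (simp add: subsequence_def W_0)
  ultimately obtain l where l: "\<And>v. factor_of_word v W \<Longrightarrow> length v = l \<Longrightarrow> sublist [0] v"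
    unfolding uniformly_recurrent_def by blast
  define v where "v = subsequence W (r ^ l * n) (r ^ l * n + l)"
  have "l < 2 ^ l" by (rule less_exp)
  also have "\<dots> \<le> r ^ l" using r_ge_2 by (intro power_mono) auto
  finally have "W (r ^ l * n + j) = 1" if "j < l" for j
    using long_runs_of_ones[OF assms, of j l] that by simp
  then have "set v \<subseteq> {1}" unfolding v_def subsequence_def by (auto simp: le_iff_add)
  moreover have "sublist [0] v" by (rule l) (auto simp: v_def factor_of_word_def)
  then have "0 \<in> set v" using set_mono_sublist by fastforce
  ultimately show False by auto
qed

end

section \<open>From generated words to fixed points\<close>

lemma word_morphism_Nil:
  assumes "word_morphism \<mu>"
  shows "\<mu> [] = []"
  using assms unfolding word_morphism_def by (metis append.right_neutral append_self_conv)

lemma length_uniform_morphism: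
  assumes "word_morphism \<mu>" and "uniform_on_letters r \<mu>"
  shows "length (\<mu> w) = r * length w"
proof (induction w)
  case (Cons a w)
  have "\<mu> (a # w) = \<mu> [a] @ \<mu> w"
    using assms(1) unfolding word_morphism_def by (metis append_Cons append_Nil)
  then show ?case using Cons assms(2) by (simp add: uniform_on_letters_def)
qed (simp add: word_morphism_Nil assms)

lemma nth_uniform_morphism:
  assumes \<mu>: "word_morphism \<mu>" "uniform_on_letters r \<mu>"
    and "n < length w" and "j < r"
  shows "\<mu> w ! (r * n + j) = \<mu> [w ! n] ! j"
proof -
  have "w = take n w @ [w ! n] @ drop (Suc n) w" using assms(3) by (simp add: id_take_nth_drop)
  then have "\<mu> w = \<mu> (take n w) @ \<mu> [w ! n] @ \<mu> (drop (Suc n) w)"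
    using \<mu>(1) unfolding word_morphism_def by metis
  then show ?thesis
    using assms length_uniform_morphism[OF \<mu>, of "take n w"]
      length_uniform_morphism[OF \<mu>, of "[w ! n]"]
    by (simp add: nth_append)
qed

text \<open>By convergence, some \<open>k\<close> has iterate \<open>k\<close> correct at
  \<open>n\<close> and iterate \<open>k + 1\<close> correct at \<open>r * n + j\<close>; one
  application of \<open>\<mu>\<close> links the two.\<close>

lemma generated_by_uniform_fixed_point:
  assumes \<mu>: "word_morphism \<mu>" "uniform_on_letters r \<mu>" and "generated_by W \<mu>"
  shows "uniform_fixed_point (\<lambda>a j. \<mu> [a] ! j) r W"
proof
  obtain a where a: "prolongable_at \<mu> a" "converges_to_word (\<lambda>k. (\<mu> ^^ k) [a]) W"
    using assms(3) unfolding generated_by_def by blast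
  obtain s where "s \<noteq> []" "\<mu> [a] = a # s" using a(1) unfolding prolongable_at_def by blast
  moreover have "length (\<mu> [a]) = r" using \<mu>(2) by (simp add: uniform_on_letters_def)
  ultimately show "2 \<le> r" by (cases s) auto
  fix j n assume j: "j < r"
  let ?u = "\<lambda>k. (\<mu> ^^ k) [a]"
  have ev: "\<forall>\<^sub>F k in sequentially. i < length (?u k) \<and> ?u k ! i = W i" for i
    using a(2) unfolding converges_to_word_def by blast
  have "\<forall>\<^sub>F k in sequentially. ?u (Suc k) ! (r * n + j) = W (r * n + j)
      \<and> n < length (?u k) \<and> ?u k ! n = W n"
    using eventually_conj[OF iffD2[OF eventually_sequentially_Suc ev[of "r * n + j"]] ev[of n]]
    by (rule eventually_mono) auto
  then obtain k where k: "?u (Suc k) ! (r * n + j) = W (r * n + j)"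
      "n < length (?u k)" "?u k ! n = W n"
    using eventually_happens' sequentially_bot by blast
  show "W (r * n + j) = \<mu> [W n] ! j"
    using nth_uniform_morphism[OF \<mu> k(2) j] k by simp
qed

theorem proposition4:
  fixes \<mu> :: "bit list \<Rightarrow> bit list" and W :: "bit word" and r :: nat
  assumes "word_morphism \<mu>"
    and "uniform_on_letters r \<mu>"
    and "generated_by W \<mu>"
    and "W 0 = 0"
  shows "(aperiodic W \<longleftrightarrow>
            \<mu> [0] \<noteq> \<mu> [1] \<and> W \<notin> {[0]\<^sup>\<omega>, [0] \<frown> [1]\<^sup>\<omega>, [0, 1]\<^sup>\<omega>})
       \<and> (uniformly_recurrent W \<longleftrightarrow> W = [0]\<^sup>\<omega> \<or> \<mu> [1] \<noteq> replicate r 1)"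
proof -
  interpret binary_fixed_point "\<lambda>a j. \<mu> [a] ! j" r W
    using generated_by_uniform_fixed_point[OF assms(1-3)] assms(4)
    by (simp add: binary_fixed_point_def binary_fixed_point_axioms_def)
  have len: "length (\<mu> [a]) = r" for a using assms(2) by (simp add: uniform_on_letters_def)
  have zeros: "W = [0]\<^sup>\<omega> \<longleftrightarrow> (\<forall>n. W n = 0)" by (auto simp: iter_def fun_eq_iff)
  have zero_ones: "W = [0] \<frown> [1]\<^sup>\<omega> \<longleftrightarrow> (\<forall>n>0. W n = 1)"
    using W_0 by (auto simp: iter_def conc_def fun_eq_iff)
  \<comment> \<open>Lets the word \<open>n \<mapsto> of_nat n\<close> stand for the periodic
    repetition of 01.\<close>
  have parity: "[0, 1] ! (n mod 2) = (of_nat n :: bit)" for n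
    by (cases "even n") (auto elim!: evenE oddE)
  have alternating: "W = [0, 1]\<^sup>\<omega> \<longleftrightarrow> (\<forall>n. W n = of_nat n)"
    using parity by (simp add: iter_def fun_eq_iff numeral_2_eq_2)
  have "aperiodic W \<longleftrightarrow>
      \<mu> [0] \<noteq> \<mu> [1] \<and> W \<notin> {[0]\<^sup>\<omega>, [0] \<frown> [1]\<^sup>\<omega>, [0, 1]\<^sup>\<omega>}" (is "_ \<longleftrightarrow> ?R")
  proof
    assume ap: "aperiodic W"
    have per: False if "p > 0" "\<And>i. i \<ge> N \<Longrightarrow> W (i + p) = W i" for p N
      using ap that unfolding aperiodic_def eventually_periodic_def by blast
    have "\<mu> [0] \<noteq> \<mu> [1]"
    proof
      assume "\<mu> [0] = \<mu> [1]"
      then have eq: "\<mu> [a] = \<mu> [0]" for a using bit_cases[of a] by auto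
      show False
      \<comment> \<open>Equal images make all aligned blocks equal, so \<open>r\<close> is a period
        from the start.\<close>
      proof (rule per[of r 0])
        show "W (i + r) = W i" for i
          using div_mod[of "i + r"] div_mod[of i]
            eq[of "W ((i + r) div r)"] eq[of "W (i div r)"] by simp
      qed (use r_ge_2 in simp)
    qed
    moreover have "W \<noteq> [0]\<^sup>\<omega>" using per[of 1 0] zeros by force
    moreover have "W \<noteq> [0] \<frown> [1]\<^sup>\<omega>" using per[of 1 1] zero_ones by force
    moreover have "W \<noteq> [0, 1]\<^sup>\<omega>" using per[of 2 0] alternating by force
    ultimately show ?R by blast
  next
    assume R: ?R
    then have "\<exists>j<r. \<mu> [0] ! j \<noteq> \<mu> [1] ! j" using len by (metis nth_equalityI)
    with R show "aperiodic W"
      using eventually_periodic_cases unfolding aperiodic_def zeros[symmetric]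
        zero_ones[symmetric] alternating[symmetric] by blast
  qed
  moreover have "uniformly_recurrent W \<longleftrightarrow> W = [0]\<^sup>\<omega> \<or> \<mu> [1] \<noteq> replicate r 1" (is "_ \<longleftrightarrow> ?R")
  proof
    assume ur: "uniformly_recurrent W"
    show ?R
    proof (rule ccontr)
      assume neg: "\<not> ?R"
      then obtain n where "W n = 1" using bit_cases zeros by blast
      then show False using not_uniformly_recurrent ur neg by simp
    qed
  next
    assume ?R
    then show "uniformly_recurrent W"
    proof
      assume "W = [0]\<^sup>\<omega>"
      then have "\<forall>n. W n = 0" by (simp add: zeros)
      then show ?thesis by (intro prefix_recurs[of 1]) auto
    next
      assume ne: "\<mu> [1] \<noteq> replicate r 1"
      have "\<exists>j<r. \<mu> [1] ! j \<noteq> 1"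
        using ne len by (metis length_replicate nth_equalityI nth_replicate)
      then show ?thesis
        using bit_cases uniformly_recurrent_if_zero_in_image by blast
    qed
  qed
  ultimately show ?thesis by blast
qed

end
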